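(* Suppose that $\Psi(\Theta)$ is countable with $\nu_\Psi$ equal to counting measure and that $\pi_\Psi(\psi)>0$ for every $\psi\in\Psi(\Theta)$. For $\eta>0$ consider the loss function $$L_{RB,\eta}(\theta,\psi)=\frac{I_{\{\psi\}^c}(\Psi(\theta))}{\max(\eta,\pi_\Psi(\Psi(\theta)))}$$ and its $\gamma$-lowest posterior loss regions $D_{\eta,\gamma}(x)$. Then $$C_{\Psi,\gamma}(x)\subset\liminf_{\eta\to0}D_{\eta,\gamma}(x)$$ whenever $\gamma$ is such that $\Pi_\Psi(C_{\Psi,\gamma}(x)\,|\,x)=\gamma$, and $$\limsup_{\eta\to0}D_{\eta,\gamma}(x)\subset C_{\Psi,\gamma'}(x)$$ whenever $\gamma'>\gamma$ and $\Pi_\Psi(C_{\Psi,\gamma'}(x)\,|\,x)=\gamma'$.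
   Context: Setting. $\{f(\cdot\,|\,\theta):\theta\in\Theta\}$ is a family of probability densities on a sample space $\mathcal X$; $\Theta$ carries a proper prior $\Pi$ with density $\pi$. The prior predictive density is $m(x)=\int_\Theta f(x\,|\,\theta)\,\Pi(d\theta)$, and the posterior has density $\pi(\theta\,|\,x)=\pi(\theta)f(x\,|\,\theta)/m(x)$, for $x$ with $0<m(x)<\infty$. $\Psi:\Theta\to\Psi(\Theta)$ is a (measurable) parameter of interest, with marginal prior $\Pi_\Psi$ and marginal posterior $\Pi_\Psi(\cdot\,|\,x)$ on $\Psi(\Theta)$, having densities $\pi_\Psi$ and $\pi_\Psi(\cdot\,|\,x)$ with respect to $\nu_\Psi$. The relative belief ratio is $RB_\Psi(\psi\,|\,x)=\pi_\Psi(\psi\,|\,x)/\pi_\Psi(\psi)$. $I_A$ is the indicator function of $A$. Credibility levels $\gamma,\gamma'$ lie in $[0,1]$. Relative belief region: $C_{\Psi,\gamma}(x)=\{\psi:RB_\Psi(\psi\,|\,x)\ge c_\gamma(x)\}$, where $c_\gamma(x)=\sup\{c:\Pi_\Psi(\{\psi:RB_\Psi(\psi\,|\,x)\ge c\}\,|\,x)\ge\gamma\}$. Lowest posterior loss region for $L_{RB,\eta}$ (the region of values $\psi$ whose posterior expected loss is at most the smallest cutoff giving posterior content at least $\gamma$) takes the form $$D_{\eta,\gamma}(x)=\Big\{\psi:\frac{\pi_\Psi(\psi\,|\,x)}{\max(\eta,\pi_\Psi(\psi))}\ge d_{\eta,\gamma}(x)\Big\},\quad d_{\eta,\gamma}(x)=\sup\Big\{d:\Pi_\Psi\Big(\Big\{\psi:\frac{\pi_\Psi(\psi\,|\,x)}{\max(\eta,\pi_\Psi(\psi))}\ge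 d\Big\}\,\Big|\,x\Big)\ge\gamma\Big\}.$$ The suprema are over extended real $c$, $d$ (relevant only when the level is $0$). For sets $A_\eta$, $\liminf_{\eta\to0}A_\eta$ is the set of points belonging to $A_\eta$ for all sufficiently small $\eta>0$, and $\limsup_{\eta\to0}A_\eta$ is the set of points belonging to $A_\eta$ for arbitrarily small $\eta>0$. *)

theory Defs
  imports "HOL-Probability.Probability"
begin

section \<open>The Bayesian model\<close>

text \<open>
  Densities on the sample space are taken with respect to \<open>\<mu>\<close>, the prior density \<open>\<pi>\<close> with respect
  to \<open>\<nu>\<close>, so that \<open>space \<nu>\<close> is the parameter space \<open>\<Theta>\<close>. The term \<open>f x \<theta>\<close> stands for \<open>f(x | \<theta>)\<close>.
\<close>

locale bayes_model =
  fixes \<mu> :: "'x measure" and \<nu> :: "'t measure"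
    and f :: "'x \<Rightarrow> 't \<Rightarrow> real" and \<pi> :: "'t \<Rightarrow> real"
  assumes f_nonneg: "\<And>x \<theta>. x \<in> space \<mu> \<Longrightarrow> \<theta> \<in> space \<nu> \<Longrightarrow> 0 \<le> f x \<theta>"
    and f_measurable_sample: "\<And>\<theta>. \<theta> \<in> space \<nu> \<Longrightarrow> (\<lambda>x. f x \<theta>) \<in> borel_measurable \<mu>"
    and f_measurable_param: "\<And>x. x \<in> space \<mu> \<Longrightarrow> f x \<in> borel_measurable \<nu>"
    and f_density: "\<And>\<theta>. \<theta> \<in> space \<nu> \<Longrightarrow> (\<integral>\<^sup>+x. ennreal (f x \<theta>) \<partial>\<mu>) = 1"
    and prior_nonneg: "\<And>\<theta>. \<theta> \<in> space \<nu> \<Longrightarrow> 0 \<le> \<pi> \<theta>"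
    and prior_measurable: "\<pi> \<in> borel_measurable \<nu>"
    and prior_proper: "(\<integral>\<^sup>+\<theta>. ennreal (\<pi> \<theta>) \<partial>\<nu>) = 1"

definition prior :: "'t measure \<Rightarrow> ('t \<Rightarrow> real) \<Rightarrow> 't measure" where
  "prior \<nu> \<pi> = density \<nu> (\<lambda>\<theta>. ennreal (\<pi> \<theta>))"

definition prior_predictive ::
    "'t measure \<Rightarrow> ('t \<Rightarrow> real) \<Rightarrow> ('x \<Rightarrow> 't \<Rightarrow> real) \<Rightarrow> 'x \<Rightarrow> ennreal" where
  "prior_predictive \<nu> \<pi> f x = (\<integral>\<^sup>+\<theta>. ennreal (f x \<theta>) \<partial>prior \<nu> \<pi>)"

definition posterior ::
    "'t measure \<Rightarrow> ('t \<Rightarrow> real) \<Rightarrow> ('x \<Rightarrow> 't \<Rightarrow> real) \<Rightarrow> 'x \<Rightarrow> 't measure" where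
  "posterior \<nu> \<pi> f x = density \<nu> (\<lambda>\<theta>. ennreal (\<pi> \<theta> * f x \<theta>) / prior_predictive \<nu> \<pi> f x)"


section \<open>Relative belief regions\<close>

text \<open>
  Below, \<open>M\<close> is the marginal posterior of the parameter of interest, a measure with space
  \<open>\<Psi>(\<Theta>)\<close>; \<open>p\<close> and \<open>q\<close> are the marginal prior and posterior densities. Cutoffs are extended reals:
  at level \<open>0\<close> the supremum is \<open>\<infinity>\<close>, and the region is empty.
\<close>

definition rel_belief_ratio :: "('p \<Rightarrow> real) \<Rightarrow> ('p \<Rightarrow> real) \<Rightarrow> 'p \<Rightarrow> real" where
  "rel_belief_ratio p q \<psi> = q \<psi> / p \<psi>"

definition rel_belief_cutoff ::
    "'p measure \<Rightarrow> ('p \<Rightarrow> real) \<Rightarrow> ('p \<Rightarrow> real) \<Rightarrow> real \<Rightarrow> ereal" where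
  "rel_belief_cutoff M p q \<gamma> =
     Sup {c. measure M {\<psi> \<in> space M. ereal (rel_belief_ratio p q \<psi>) \<ge> c} \<ge> \<gamma>}"

definition rel_belief_region ::
    "'p measure \<Rightarrow> ('p \<Rightarrow> real) \<Rightarrow> ('p \<Rightarrow> real) \<Rightarrow> real \<Rightarrow> 'p set" where
  "rel_belief_region M p q \<gamma> =
     {\<psi> \<in> space M. ereal (rel_belief_ratio p q \<psi>) \<ge> rel_belief_cutoff M p q \<gamma>}"


section \<open>Lowest posterior loss regions\<close>

text \<open>\<open>P\<close> is the posterior on the full parameter space.\<close>

definition posterior_loss :: "'t measure \<Rightarrow> ('t \<Rightarrow> 'p \<Rightarrow> real) \<Rightarrow> 'p \<Rightarrow> real" where
  "posterior_loss P L \<psi> = (\<integral>\<theta>. L \<theta> \<psi> \<partial>P)"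

definition lpl_cutoff ::
    "'t measure \<Rightarrow> 'p measure \<Rightarrow> ('t \<Rightarrow> 'p \<Rightarrow> real) \<Rightarrow> real \<Rightarrow> ereal" where
  "lpl_cutoff P M L \<gamma> =
     Inf {k. measure M {\<psi> \<in> space M. ereal (posterior_loss P L \<psi>) \<le> k} \<ge> \<gamma>}"

definition lpl_region ::
    "'t measure \<Rightarrow> 'p measure \<Rightarrow> ('t \<Rightarrow> 'p \<Rightarrow> real) \<Rightarrow> real \<Rightarrow> 'p set" where
  "lpl_region P M L \<gamma> = {\<psi> \<in> space M. ereal (posterior_loss P L \<psi>) \<le> lpl_cutoff P M L \<gamma>}"

definition rb_loss :: "('t \<Rightarrow> 'p) \<Rightarrow> ('p \<Rightarrow> real) \<Rightarrow> real \<Rightarrow> 't \<Rightarrow> 'p \<Rightarrow> real" where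
  "rb_loss \<Psi> p \<eta> \<theta> \<psi> = indicator (- {\<psi>}) (\<Psi> \<theta>) / max \<eta> (p (\<Psi> \<theta>))"

text \<open>
  For \<open>rb_loss\<close> the posterior expected loss is finite and equals a constant minus
  \<open>q \<psi> / max \<eta> (p \<psi>)\<close>, so the regions have the expected form.
\<close>

lemma
  assumes P: "finite_measure P"
    and q: "distributed P (count_space S) \<Psi> (\<lambda>\<psi>. ennreal (q \<psi>))"
    and q_nonneg: "\<And>\<psi>. \<psi> \<in> S \<Longrightarrow> 0 \<le> q \<psi>"
    and \<eta>: "0 < \<eta>"
  shows integrable_rb_loss: "integrable P (\<lambda>\<theta>. rb_loss \<Psi> p \<eta> \<theta> \<psi>)"
    and posterior_loss_rb_loss: "\<psi> \<in> S \<Longrightarrow> posterior_loss P (rb_loss \<Psi> p \<eta>) \<psi> =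
          (\<integral>\<theta>. 1 / max \<eta> (p (\<Psi> \<theta>)) \<partial>P) - q \<psi> / max \<eta> (p \<psi>)"
proof -
  interpret finite_measure P by (rule P)
  have \<Psi>: "\<Psi> \<in> measurable P (count_space S)"
    using q by (simp add: distributed_def)
  have meas: "(\<lambda>\<theta>. g (\<Psi> \<theta>)) \<in> borel_measurable P" for g :: "_ \<Rightarrow> real"
    by (rule measurable_compose[OF \<Psi>]) simp
  have bound: "\<bar>c / max \<eta> y\<bar> \<le> 1 / \<eta>" if "0 \<le> c" "c \<le> 1" for c y :: real
    using that \<eta> by (auto simp: abs_of_nonneg intro!: frac_le)
  have int: "integrable P (\<lambda>\<theta>. indicator A (\<Psi> \<theta>) / max \<eta> (p (\<Psi> \<theta>)))" for A
    by (rule integrable_const_bound[where B="1 / \<eta>"])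
       (auto intro!: AE_I2 bound meas simp: indicator_def less_imp_le[OF \<eta>] simp del: abs_divide)
  show "integrable P (\<lambda>\<theta>. rb_loss \<Psi> p \<eta> \<theta> \<psi>)"
    unfolding rb_loss_def by (rule int)
  assume \<psi>: "\<psi> \<in> S"
  have "emeasure P (\<Psi> -` {\<psi>} \<inter> space P) = emeasure (distr P (count_space S) \<Psi>) {\<psi>}"
    using \<psi> by (subst emeasure_distr[OF \<Psi>]) auto
  also have "\<dots> = emeasure (density (count_space S) (\<lambda>\<psi>. ennreal (q \<psi>))) {\<psi>}"
    using q by (simp add: distributed_def)
  also have "\<dots> = ennreal (q \<psi>)"
    using \<psi> by (subst emeasure_density) (auto simp: nn_integral_cmult_indicator)
  finally have mq: "measure P (\<Psi> -` {\<psi>} \<inter> space P) = q \<psi>"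
    using q_nonneg[OF \<psi>] by (simp add: measure_def)
  have sets: "\<Psi> -` {\<psi>} \<inter> space P \<in> sets P"
    using measurable_sets[OF \<Psi>, of "{\<psi>}"] \<psi> by auto
  have "posterior_loss P (rb_loss \<Psi> p \<eta>) \<psi> =
     (\<integral>\<theta>. indicator UNIV (\<Psi> \<theta>) / max \<eta> (p (\<Psi> \<theta>)) - indicator {\<psi>} (\<Psi> \<theta>) / max \<eta> (p (\<Psi> \<theta>)) \<partial>P)"
    unfolding posterior_loss_def rb_loss_def
    by (rule Bochner_Integration.integral_cong) (auto simp: indicator_def)
  also have "\<dots> = (\<integral>\<theta>. indicator UNIV (\<Psi> \<theta>) / max \<eta> (p (\<Psi> \<theta>)) \<partial>P) -
      (\<integral>\<theta>. indicator {\<psi>} (\<Psi> \<theta>) / max \<eta> (p (\<Psi> \<theta>)) \<partial>P)"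
    by (rule Bochner_Integration.integral_diff[OF int int])
  also have "(\<integral>\<theta>. indicator {\<psi>} (\<Psi> \<theta>) / max \<eta> (p (\<Psi> \<theta>)) \<partial>P) =
      (\<integral>\<theta>. indicator (\<Psi> -` {\<psi>} \<inter> space P) \<theta> / max \<eta> (p \<psi>) \<partial>P)"
    by (rule Bochner_Integration.integral_cong) (auto simp: indicator_def)
  also have "\<dots> = q \<psi> / max \<eta> (p \<psi>)"
    using sets by (simp add: mq)
  finally show "posterior_loss P (rb_loss \<Psi> p \<eta>) \<psi> =
      (\<integral>\<theta>. 1 / max \<eta> (p (\<Psi> \<theta>)) \<partial>P) - q \<psi> / max \<eta> (p \<psi>)" by simp
qed

lemma lpl_region_rb_loss:
  assumes P: "finite_measure P"
    and q: "distributed P (count_space S) \<Psi> (\<lambda>\<psi>. ennreal (q \<psi>))"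
    and q_nonneg: "\<And>\<psi>. \<psi> \<in> S \<Longrightarrow> 0 \<le> q \<psi>"
    and \<eta>: "0 < \<eta>"
  defines "M \<equiv> distr P (count_space S) \<Psi>"
  shows "lpl_region P M (rb_loss \<Psi> p \<eta>) \<gamma> =
    {\<psi> \<in> S. ereal (q \<psi> / max \<eta> (p \<psi>)) \<ge>
       Sup {d. measure M {\<psi> \<in> S. ereal (q \<psi> / max \<eta> (p \<psi>)) \<ge> d} \<ge> \<gamma>}}"
proof -
  define K where "K = (\<integral>\<theta>. 1 / max \<eta> (p (\<Psi> \<theta>)) \<partial>P)"
  define g where "g = (\<lambda>\<psi>. q \<psi> / max \<eta> (p \<psi>))"
  have sp: "space M = S" by (simp add: M_def)
  have loss: "posterior_loss P (rb_loss \<Psi> p \<eta>) \<psi> = K - g \<psi>" if "\<psi> \<in> S" for \<psi>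
    unfolding K_def g_def using posterior_loss_rb_loss[OF P q q_nonneg \<eta>] that by simp
  have flip1: "ereal (K - y) \<le> k \<longleftrightarrow> ereal K - k \<le> ereal y" for k y by (cases k) auto
  have flip2: "d \<le> ereal y \<longleftrightarrow> ereal (K - y) \<le> ereal K - d" for d y by (cases d) auto
  have set1: "{\<psi> \<in> space M. ereal (posterior_loss P (rb_loss \<Psi> p \<eta>) \<psi>) \<le> k} =
      {\<psi> \<in> S. ereal K - k \<le> ereal (g \<psi>)}" for k
    unfolding sp using loss flip1 by auto
  have set2: "{\<psi> \<in> S. ereal K - (ereal K - d) \<le> ereal (g \<psi>)} = {\<psi> \<in> S. d \<le> ereal (g \<psi>)}" for d
    using flip1 flip2 by (metis (no_types, opaque_lifting))
  have key: "ereal (K - y) \<le> Inf {k. \<gamma> \<le> measure M {\<psi> \<in> S. ereal K - k \<le> ereal (g \<psi>)}} \<longleftrightarrow>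
        Sup {d. \<gamma> \<le> measure M {\<psi> \<in> S. d \<le> ereal (g \<psi>)}} \<le> ereal y"
    (is "_ \<le> Inf ?A \<longleftrightarrow> Sup ?B \<le> _") for y
  proof
    assume *: "ereal (K - y) \<le> Inf ?A"
    show "Sup ?B \<le> ereal y"
    proof (rule Sup_least)
      fix d assume "d \<in> ?B"
      then have "ereal K - d \<in> ?A" by (simp add: set2)
      then show "d \<le> ereal y" using * flip2 by (auto simp: le_Inf_iff)
    qed
  next
    assume *: "Sup ?B \<le> ereal y"
    show "ereal (K - y) \<le> Inf ?A"
    proof (rule Inf_greatest)
      fix k assume "k \<in> ?A"
      then have "ereal K - k \<in> ?B" by simp
      then show "ereal (K - y) \<le> k" using * flip1 by (auto simp: Sup_le_iff)
    qed
  qed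
  have "lpl_region P M (rb_loss \<Psi> p \<eta>) \<gamma> =
      {\<psi> \<in> S. Sup {d. \<gamma> \<le> measure M {\<psi> \<in> S. d \<le> ereal (g \<psi>)}} \<le> ereal (g \<psi>)}"
    unfolding lpl_region_def lpl_cutoff_def set1 unfolding sp
    by (intro Collect_cong conj_cong refl) (simp only: key[unfolded flip1])
  then show ?thesis
    by (simp only: g_def)
qed


section \<open>Limits of sets\<close>

text \<open>
  Limits inferior and superior of sets as \<open>\<eta> \<down> 0\<close> are the library's \<open>Liminf\<close> and \<open>Limsup\<close>
  in the complete lattice of sets, along \<open>at_right 0\<close>.
\<close>

lemma mem_Liminf_set_iff: "a \<in> Liminf F A \<longleftrightarrow> (\<forall>\<^sub>F \<eta> in F. a \<in> A \<eta>)"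
  unfolding Liminf_def by (auto elim: eventually_mono)

lemma mem_Limsup_set_iff: "a \<in> Limsup F A \<longleftrightarrow> (\<exists>\<^sub>F \<eta> in F. a \<in> A \<eta>)"
proof
  assume a: "a \<in> Limsup F A"
  show "\<exists>\<^sub>F \<eta> in F. a \<in> A \<eta>"
    unfolding frequently_def
  proof
    assume "\<forall>\<^sub>F \<eta> in F. a \<notin> A \<eta>"
    with a have "a \<in> (\<Union>\<eta>\<in>{\<eta>. a \<notin> A \<eta>}. A \<eta>)"
      unfolding Limsup_def by auto
    then show False by auto
  qed
next
  assume a: "\<exists>\<^sub>F \<eta> in F. a \<in> A \<eta>"
  have "\<exists>\<eta>. P \<eta> \<and> a \<in> A \<eta>" if "eventually P F" for P
    using frequently_ex[OF frequently_eventually_frequently[OF a that]] by auto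
  then show "a \<in> Limsup F A"
    unfolding Limsup_def by auto
qed

lemma mem_Liminf_at_right_0_iff:
  fixes A :: "real \<Rightarrow> 'a set"
  shows "a \<in> Liminf (at_right 0) A \<longleftrightarrow> (\<exists>\<epsilon>>0. \<forall>\<eta>. 0 < \<eta> \<and> \<eta> < \<epsilon> \<longrightarrow> a \<in> A \<eta>)"
  unfolding mem_Liminf_set_iff eventually_at_right_field by auto

lemma mem_Limsup_at_right_0_iff:
  fixes A :: "real \<Rightarrow> 'a set"
  shows "a \<in> Limsup (at_right 0) A \<longleftrightarrow> (\<forall>\<epsilon>>0. \<exists>\<eta>. 0 < \<eta> \<and> \<eta> < \<epsilon> \<and> a \<in> A \<eta>)"
  unfolding mem_Limsup_set_iff frequently_def eventually_at_right_field by auto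

end

theory Submission
  imports Defs
begin

text \<open>
  Write \<open>r = q / p\<close> for the relative belief ratio and \<open>r\<^sub>\<eta> = q / max \<eta> p\<close> for the score whose upper
  level sets are the lowest posterior loss regions. Both families of regions arise from a score in the
  same way: the cutoff at level \<open>\<gamma>\<close> is the supremum of the values whose upper level set still has
  content at least \<open>\<gamma>\<close>. Everything rests on two relations between the scores: \<open>r\<^sub>\<eta> \<le> r\<close> everywhere, and
  \<open>r\<^sub>\<eta> \<psi> = r \<psi>\<close> as soon as \<open>\<eta> \<le> p \<psi>\<close>.

  Lower inclusion. Lowering a score lowers its cutoff, so the cutoff of \<open>r\<^sub>\<eta>\<close> is at most that of \<open>r\<close>
  (\<open>score_cutoff_mono\<close>). A point \<open>\<psi>\<close> of the relative belief region keeps its score once \<open>\<eta> \<le> p \<psi>\<close>,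
  hence passes the lower threshold.

  Upper inclusion. The sets \<open>{\<psi>. \<eta> \<le> p \<psi>}\<close> increase to the whole space as \<open>\<eta> \<down> 0\<close> because \<open>p\<close> is
  positive, so by continuity from below the part of \<open>C \<gamma>'\<close> on which \<open>r\<^sub>\<eta> = r\<close> has content above \<open>\<gamma>\<close>
  for small \<open>\<eta>\<close> (\<open>eventually_measure_truncation_gt\<close>). The cutoff of \<open>C \<gamma>'\<close> is therefore
  admissible for \<open>r\<^sub>\<eta>\<close> at level \<open>\<gamma>\<close>, the cutoff of \<open>r\<^sub>\<eta>\<close> is at least as large, and any point passing
  it with \<open>r\<^sub>\<eta> \<le> r\<close> lies in \<open>C \<gamma>'\<close>.
\<close>

definition score_cutoff :: "'p measure \<Rightarrow> ('p \<Rightarrow> real) \<Rightarrow> real \<Rightarrow> ereal" where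
  "score_cutoff M g \<gamma> = Sup {c. \<gamma> \<le> measure M {\<psi> \<in> space M. c \<le> ereal (g \<psi>)}}"

lemma le_score_cutoff:
  "\<gamma> \<le> measure M {\<psi> \<in> space M. c \<le> ereal (g \<psi>)} \<Longrightarrow> c \<le> score_cutoff M g \<gamma>"
  unfolding score_cutoff_def by (rule Sup_upper) simp

lemma (in finite_measure) score_cutoff_mono:
  assumes [measurable]: "h \<in> borel_measurable M"
    and le: "\<And>\<psi>. \<psi> \<in> space M \<Longrightarrow> g \<psi> \<le> h \<psi>"
  shows "score_cutoff M g \<gamma> \<le> score_cutoff M h \<gamma>"
  unfolding score_cutoff_def
proof (rule Sup_subset_mono, safe)
  fix c assume "\<gamma> \<le> measure M {\<psi> \<in> space M. c \<le> ereal (g \<psi>)}"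
  also have "\<dots> \<le> measure M {\<psi> \<in> space M. c \<le> ereal (h \<psi>)}"
    using le by (intro finite_measure_mono) (auto intro: order_trans)
  finally show "\<gamma> \<le> measure M {\<psi> \<in> space M. c \<le> ereal (h \<psi>)}" .
qed

text \<open>
  Continuity of the measure from below along the truncations by \<open>\<eta> = 1 / (n + 1)\<close>, transferred to
  all small \<open>\<eta>\<close> because the truncated sets grow as \<open>\<eta>\<close> decreases.
\<close>

lemma (in finite_measure) eventually_measure_truncation_gt:
  fixes p :: "'a \<Rightarrow> real"
  assumes [measurable]: "A \<in> sets M" "p \<in> borel_measurable M"
    and pos: "\<And>\<psi>. \<psi> \<in> A \<Longrightarrow> 0 < p \<psi>"
    and gt: "\<gamma> < measure M A"
  shows "\<forall>\<^sub>F \<eta> in at_right 0. \<gamma> < measure M {\<psi> \<in> A. \<eta> \<le> p \<psi>}"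
proof -
  define B where "B = (\<lambda>\<eta>. {\<psi> \<in> A. \<eta> \<le> p \<psi>})"
  have B_eq: "B \<eta> = A \<inter> {\<psi> \<in> space M. \<eta> \<le> p \<psi>}" for \<eta>
    using sets.sets_into_space[OF assms(1)] by (auto simp: B_def)
  have B_sets: "B \<eta> \<in> sets M" for \<eta>
    unfolding B_eq by measurable
  have "incseq (\<lambda>n. B (1 / real (Suc n)))"
  proof (rule incseq_SucI)
    have "1 / real (Suc (Suc n)) \<le> 1 / real (Suc n)" for n
      by (rule frac_le) simp_all
    then show "B (1 / real (Suc n)) \<subseteq> B (1 / real (Suc (Suc n)))" for n
      unfolding B_def using order_trans by blast
  qed
  then have "(\<lambda>n. measure M (B (1 / real (Suc n)))) \<longlonglongrightarrow> measure M (\<Union>n. B (1 / real (Suc n)))"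
    using B_sets by (intro finite_Lim_measure_incseq) auto
  also have "(\<Union>n. B (1 / real (Suc n))) = A"
  proof (intro equalityI subsetI)
    fix \<psi> assume \<psi>: "\<psi> \<in> A"
    then obtain n where "1 / real (Suc n) < p \<psi>"
      using pos nat_approx_posE by blast
    with \<psi> show "\<psi> \<in> (\<Union>n. B (1 / real (Suc n)))"
      by (auto simp: B_def intro!: exI[of _ n])
  qed (auto simp: B_def)
  finally have "\<forall>\<^sub>F n in sequentially. \<gamma> < measure M (B (1 / real (Suc n)))"
    using gt by (rule order_tendstoD(1))
  then obtain N where N: "\<gamma> < measure M (B (1 / real (Suc N)))"
    using eventually_happens by force
  have "\<gamma> < measure M (B \<eta>)" if "\<eta> < 1 / real (Suc N)" for \<eta>
    by (rule less_le_trans[OF N finite_measure_mono]) (use that B_sets in \<open>auto simp: B_def\<close>)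
  then show ?thesis
    unfolding B_def eventually_at_right_field by (meson of_nat_0_less_iff zero_less_Suc zero_less_divide_1_iff)
qed

lemma rel_belief_region_eq_score:
  "rel_belief_region M p q \<gamma> =
     {\<psi> \<in> space M. score_cutoff M (\<lambda>\<psi>. q \<psi> / p \<psi>) \<gamma> \<le> ereal (q \<psi> / p \<psi>)}"
  by (simp add: rel_belief_region_def rel_belief_cutoff_def score_cutoff_def rel_belief_ratio_def)

lemma truncated_ratio_le:
  fixes p q \<eta> :: real
  assumes "0 < p" "0 \<le> q"
  shows "q / max \<eta> p \<le> q / p"
  using assms by (intro divide_left_mono mult_pos_pos) auto

text \<open>
  The normalising constant is the predictive density at the observation, so its finiteness and
  positivity are exactly what makes the posterior a probability measure.
\<close>

lemma (in bayes_model) prob_space_posterior: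
  assumes x: "x \<in> space \<mu>"
    and m: "0 < prior_predictive \<nu> \<pi> f x" "prior_predictive \<nu> \<pi> f x < \<infinity>"
  shows "prob_space (posterior \<nu> \<pi> f x)"
proof
  let ?m = "prior_predictive \<nu> \<pi> f x"
  note [measurable] = f_measurable_param[OF x] prior_measurable
  have "?m = (\<integral>\<^sup>+\<theta>. ennreal (\<pi> \<theta>) * ennreal (f x \<theta>) \<partial>\<nu>)"
    unfolding prior_predictive_def prior_def by (subst nn_integral_density) simp_all
  also have "\<dots> = (\<integral>\<^sup>+\<theta>. ennreal (\<pi> \<theta> * f x \<theta>) \<partial>\<nu>)"
    using prior_nonneg f_nonneg[OF x] by (intro nn_integral_cong) (simp add: ennreal_mult)
  finally have m_eq: "(\<integral>\<^sup>+\<theta>. ennreal (\<pi> \<theta> * f x \<theta>) \<partial>\<nu>) = ?m" ..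
  have "emeasure (posterior \<nu> \<pi> f x) (space (posterior \<nu> \<pi> f x)) =
      (\<integral>\<^sup>+\<theta>. ennreal (\<pi> \<theta> * f x \<theta>) / ?m \<partial>\<nu>)"
    unfolding posterior_def by (simp add: emeasure_density cong: nn_integral_cong)
  also have "\<dots> = ?m / ?m"
    by (subst nn_integral_divide) (simp_all add: m_eq)
  also have "\<dots> = 1"
    using m by (intro ennreal_divide_self) auto
  finally show "emeasure (posterior \<nu> \<pi> f x) (space (posterior \<nu> \<pi> f x)) = 1" .
qed

theorem theorem9:
  fixes \<mu> :: "'x measure" and \<nu> :: "'t measure"
    and f :: "'x \<Rightarrow> 't \<Rightarrow> real" and \<pi> :: "'t \<Rightarrow> real" and x :: 'x
    and \<Psi> :: "'t \<Rightarrow> 'p" and \<nu>\<^sub>\<Psi> :: "'p measure"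
    and p q :: "'p \<Rightarrow> real" and \<gamma> :: real
  assumes model: "bayes_model \<mu> \<nu> f \<pi>"
    and x: "x \<in> space \<mu>"
    and predictive: "0 < prior_predictive \<nu> \<pi> f x" "prior_predictive \<nu> \<pi> f x < \<infinity>"
    and countable: "countable (\<Psi> ` space \<nu>)"
    and counting: "\<nu>\<^sub>\<Psi> = count_space (\<Psi> ` space \<nu>)"
    and prior_density: "distributed (prior \<nu> \<pi>) \<nu>\<^sub>\<Psi> \<Psi> (\<lambda>\<psi>. ennreal (p \<psi>))"
    and posterior_density: "distributed (posterior \<nu> \<pi> f x) \<nu>\<^sub>\<Psi> \<Psi> (\<lambda>\<psi>. ennreal (q \<psi>))"
    and p_pos: "\<And>\<psi>. \<psi> \<in> \<Psi> ` space \<nu> \<Longrightarrow> 0 < p \<psi>"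
    and q_nonneg: "\<And>\<psi>. \<psi> \<in> \<Psi> ` space \<nu> \<Longrightarrow> 0 \<le> q \<psi>"
    and \<gamma>: "0 \<le> \<gamma>" "\<gamma> \<le> 1"
  shows "let P = posterior \<nu> \<pi> f x;
             M = distr P \<nu>\<^sub>\<Psi> \<Psi>;
             C = rel_belief_region M p q;
             D = (\<lambda>\<eta>. lpl_region P M (rb_loss \<Psi> p \<eta>))
         in (measure M (C \<gamma>) = \<gamma> \<longrightarrow> C \<gamma> \<subseteq> Liminf (at_right 0) (\<lambda>\<eta>. D \<eta> \<gamma>)) \<and>
            (\<forall>\<gamma>'. \<gamma> < \<gamma>' \<and> \<gamma>' \<le> 1 \<and> measure M (C \<gamma>') = \<gamma>' \<longrightarrow>
               Limsup (at_right 0) (\<lambda>\<eta>. D \<eta> \<gamma>) \<subseteq> C \<gamma>')"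
proof -
  define P where "P = posterior \<nu> \<pi> f x"
  define S where "S = \<Psi> ` space \<nu>"
  define M where "M = distr P (count_space S) \<Psi>"
  define r where "r = (\<lambda>\<psi>. q \<psi> / p \<psi>)"
  define r\<^sub>t where "r\<^sub>t = (\<lambda>\<eta> \<psi>. q \<psi> / max \<eta> (p \<psi>))"
  have P: "prob_space P"
    unfolding P_def by (rule bayes_model.prob_space_posterior[OF model x predictive])
  have finP: "finite_measure P"
    using P by (rule prob_space.finite_measure)
  have q_density: "distributed P (count_space S) \<Psi> (\<lambda>\<psi>. ennreal (q \<psi>))"
    using posterior_density unfolding P_def S_def counting .
  have sp: "space M = S" and sets_M: "sets M = Pow S"
    by (simp_all add: M_def)
  have meas: "g \<in> borel_measurable M" for g :: "'p \<Rightarrow> real"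
    by (simp add: M_def)
  interpret M: finite_measure M
    unfolding M_def using q_density
    by (intro finite_measure.finite_measure_distr[OF finP]) (simp add: distributed_def)
  have C_eq: "rel_belief_region M p q \<delta> = {\<psi> \<in> S. score_cutoff M r \<delta> \<le> ereal (r \<psi>)}" for \<delta>
    unfolding rel_belief_region_eq_score sp r_def ..
  have D_eq: "lpl_region P M (rb_loss \<Psi> p \<eta>) \<gamma> = {\<psi> \<in> S. score_cutoff M (r\<^sub>t \<eta>) \<gamma> \<le> ereal (r\<^sub>t \<eta> \<psi>)}"
    if "0 < \<eta>" for \<eta>
    unfolding score_cutoff_def sp r\<^sub>t_def unfolding M_def
    by (rule lpl_region_rb_loss[OF finP q_density q_nonneg[folded S_def] that])
  have le: "r\<^sub>t \<eta> \<psi> \<le> r \<psi>" if "\<psi> \<in> S" for \<eta> \<psi>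
    using truncated_ratio_le p_pos q_nonneg that unfolding r_def r\<^sub>t_def S_def by blast
  have eq: "r\<^sub>t \<eta> \<psi> = r \<psi>" if "\<eta> \<le> p \<psi>" for \<eta> \<psi>
    using that by (simp add: r_def r\<^sub>t_def max_absorb2)

  have lower: "\<psi> \<in> Liminf (at_right 0) (\<lambda>\<eta>. lpl_region P M (rb_loss \<Psi> p \<eta>) \<gamma>)"
    if "\<psi> \<in> rel_belief_region M p q \<gamma>" for \<psi>
  proof -
    have \<psi>: "\<psi> \<in> S" "score_cutoff M r \<gamma> \<le> ereal (r \<psi>)"
      using that by (simp_all add: C_eq)
    have "\<psi> \<in> lpl_region P M (rb_loss \<Psi> p \<eta>) \<gamma>" if \<eta>: "0 < \<eta>" "\<eta> < p \<psi>" for \<eta>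
    proof -
      have "score_cutoff M (r\<^sub>t \<eta>) \<gamma> \<le> score_cutoff M r \<gamma>"
        by (rule M.score_cutoff_mono[OF meas]) (simp add: sp le)
      with \<psi> \<eta> show ?thesis
        by (simp add: D_eq eq)
    qed
    moreover have "0 < p \<psi>"
      using p_pos \<psi>(1) by (simp add: S_def)
    ultimately show ?thesis
      unfolding mem_Liminf_at_right_0_iff by blast
  qed

  have upper: "\<psi> \<in> rel_belief_region M p q \<gamma>'"
    if \<gamma>': "\<gamma> < \<gamma>'" "measure M (rel_belief_region M p q \<gamma>') = \<gamma>'"
      and \<psi>: "\<psi> \<in> Limsup (at_right 0) (\<lambda>\<eta>. lpl_region P M (rb_loss \<Psi> p \<eta>) \<gamma>)" for \<gamma>' \<psi>
  proof -
    let ?C = "rel_belief_region M p q \<gamma>'"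
    have "\<forall>\<^sub>F \<eta> in at_right 0. \<gamma> < measure M {\<psi> \<in> ?C. \<eta> \<le> p \<psi>}"
      using \<gamma>' p_pos
      by (intro M.eventually_measure_truncation_gt meas) (auto simp: C_eq sets_M S_def)
    then have "\<forall>\<^sub>F \<eta> in at_right 0. 0 < \<eta> \<and> \<gamma> < measure M {\<psi> \<in> ?C. \<eta> \<le> p \<psi>}"
      using eventually_at_right_less by (rule eventually_elim2) simp
    moreover have "\<exists>\<^sub>F \<eta> in at_right 0. \<psi> \<in> lpl_region P M (rb_loss \<Psi> p \<eta>) \<gamma>"
      using \<psi> unfolding mem_Limsup_set_iff .
    ultimately obtain \<eta> where \<eta>: "0 < \<eta>" "\<gamma> < measure M {\<psi> \<in> ?C. \<eta> \<le> p \<psi>}"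
      and D: "\<psi> \<in> lpl_region P M (rb_loss \<Psi> p \<eta>) \<gamma>"
      using frequently_ex[OF frequently_eventually_frequently] by force
    note \<eta>(2)
    also have "measure M {\<psi> \<in> ?C. \<eta> \<le> p \<psi>} \<le>
        measure M {\<psi> \<in> space M. score_cutoff M r \<gamma>' \<le> ereal (r\<^sub>t \<eta> \<psi>)}"
      by (rule M.finite_measure_mono) (auto simp: C_eq sets_M sp eq)
    finally have "score_cutoff M r \<gamma>' \<le> score_cutoff M (r\<^sub>t \<eta>) \<gamma>"
      by (intro le_score_cutoff) simp
    also have "\<dots> \<le> ereal (r\<^sub>t \<eta> \<psi>)"
      using D D_eq[OF \<eta>(1)] by simp
    also have "\<dots> \<le> ereal (r \<psi>)"
      using D D_eq[OF \<eta>(1)] le by simp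
    finally show ?thesis
      using D D_eq[OF \<eta>(1)] by (simp add: C_eq)
  qed

  show ?thesis
    using lower upper
    unfolding Let_def counting P_def[symmetric] S_def[symmetric] M_def[symmetric] by blast
qed

end
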